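(* Let $k\ge0$ and $n\ge2$ be integers, and for $1\le i\le k$ put $x_i=\sum_{j=1}^{i}\frac{B_j^+\,s(i,j)}{j}J_j(n)$. Then \[\frac{\Phi_n^{(k)}(1)}{\Phi_n(1)}=\mathcal{B}_k(x_1,\dots,x_k).\]
   Context: $\Phi_n$ is the $n$-th cyclotomic polynomial. $s(i,j)$ are the signed Stirling numbers of the first kind: $x(x-1)\cdots(x-i+1)=\sum_{j=0}^i s(i,j)x^j$. $B_j^+$ are defined by $\frac{te^t}{e^t-1}=\sum_{j\ge0}B_j^+t^j/j!$. $J_j(n)=n^j\prod_{p\mid n}(1-p^{-j})$ is the Jordan totient function. The complete Bell polynomial is $\mathcal{B}_k(x_1,\dots,x_k)=\sum \frac{k!}{\lambda_1!\cdots\lambda_k!}\prod_{j=1}^k\left(\frac{x_j}{j!}\right)^{\lambda_j}$, the sum over all tuples of non-negative integers $(\lambda_1,\dots,\lambda_k)$ with $\sum_j j\lambda_j=k$; $\mathcal{B}_0=1$. *)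

theory Defs
  imports
    "HOL-Computational_Algebra.Computational_Algebra"
    "HOL-Library.FuncSet"
begin

definition cyclotomic :: "nat \<Rightarrow> complex poly" where
  "cyclotomic n =
    (\<Prod>z | z ^ n = 1 \<and> (\<forall>m. 0 < m \<and> m < n \<longrightarrow> z ^ m \<noteq> 1). [:- z, 1:])"

definition signed_stirling :: "nat \<Rightarrow> nat \<Rightarrow> int" where
  "signed_stirling i j = coeff (\<Prod>m<i. [:- int m, 1:]) j"

lemma signed_stirling_falling_factorial:
  "(\<Prod>m<i. x - int m) = (\<Sum>j\<le>i. signed_stirling i j * x ^ j)"
proof -
  let ?p = "\<Prod>m<i. [:- int m, 1:]"
  have "degree ?p \<le> (\<Sum>m<i. degree [:- int m, 1:])"
    using degree_prod_sum_le[of "{..<i}" "\<lambda>m. [:- int m, 1:]"] by (simp add: o_def)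
  hence "degree ?p \<le> i" by simp
  hence "poly ?p x = (\<Sum>j\<le>i. coeff ?p j * x ^ j)"
    unfolding poly_altdef by (intro sum.mono_neutral_left) (auto simp: coeff_eq_0)
  thus ?thesis by (simp add: signed_stirling_def poly_prod)
qed

definition bernoulli_plus :: "nat \<Rightarrow> 'a :: field_char_0" where
  "bernoulli_plus j = fact j * fps_nth (fps_X * fps_exp 1 / (fps_exp 1 - 1)) j"

(* Division of formal power series is total; this shows that the quotient above is exact. *)
lemma bernoulli_plus_egf:
  "Abs_fps (\<lambda>j. bernoulli_plus j / fact j) * (fps_exp 1 - 1) =
     fps_X * fps_exp (1 :: 'a :: field_char_0)"
proof -
  let ?d = "fps_exp (1 :: 'a) - 1"
  have nz: "?d \<noteq> 0"
  proof
    assume "?d = 0"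
    hence "fps_nth ?d 1 = 0" by simp
    thus False by simp
  qed
  have "subdegree ?d = 1" by (rule subdegreeI) auto
  moreover have "subdegree (fps_X * fps_exp (1 :: 'a)) = 1"
    by (rule subdegreeI) auto
  ultimately have "?d dvd fps_X * fps_exp 1"
    using nz by (subst fps_dvd_iff) auto
  moreover have "Abs_fps (\<lambda>j. bernoulli_plus j / fact j) = fps_X * fps_exp 1 / ?d"
    by (simp add: fps_eq_iff bernoulli_plus_def)
  ultimately show ?thesis by simp
qed

definition jordan_totient :: "nat \<Rightarrow> nat \<Rightarrow> 'a :: field_char_0" where
  "jordan_totient j n = of_nat n ^ j * (\<Prod>p\<in>prime_factors n. 1 - 1 / of_nat p ^ j)"

definition bell_tuples :: "nat \<Rightarrow> (nat \<Rightarrow> nat) set" where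
  "bell_tuples k = {l \<in> {1..k} \<rightarrow>\<^sub>E UNIV. (\<Sum>j=1..k. j * l j) = k}"

(* The sum over bell_tuples below is therefore a genuine finite sum. *)
lemma finite_bell_tuples: "finite (bell_tuples k)"
proof (rule finite_subset)
  show "bell_tuples k \<subseteq> {1..k} \<rightarrow>\<^sub>E {..k}"
  proof
    fix l assume l: "l \<in> bell_tuples k"
    have "l j \<le> k" if j: "j \<in> {1..k}" for j
    proof -
      have "l j \<le> j * l j" using j by simp
      also have "\<dots> \<le> (\<Sum>j=1..k. j * l j)"
        using j by (intro member_le_sum[of j "{1..k}" "\<lambda>j. j * l j"]) auto
      also have "\<dots> = k" using l by (simp add: bell_tuples_def)
      finally show ?thesis .
    qed
    thus "l \<in> {1..k} \<rightarrow>\<^sub>E {..k}" using l by (auto simp: bell_tuples_def PiE_iff)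
  qed
qed (simp add: finite_PiE)

definition complete_bell :: "nat \<Rightarrow> (nat \<Rightarrow> 'a :: field_char_0) \<Rightarrow> 'a" where
  "complete_bell k x =
    (\<Sum>l\<in>bell_tuples k.
       fact k / (\<Prod>j=1..k. fact (l j)) * (\<Prod>j=1..k. (x j / fact j) ^ l j))"

end

theory Submission
  imports Defs
begin

text \<open>
  Substitute \<open>x = e\<^sup>s\<close>. The logarithmic derivative of \<open>e\<^sup>n\<^sup>s - 1\<close>, multiplied by \<open>s\<close>, is the
  generating function of the \<open>B\<^sub>j\<^sup>+\<close> evaluated at \<open>n s\<close>. It is the sum over \<open>d dvd n\<close> of the
  corresponding series for the \<open>d\<close>-th cyclotomic polynomial, and \<open>n\<^sup>j\<close> is the sum of the
  \<open>J\<^sub>j(d)\<close>, so strong induction on \<open>n\<close> replaces Moebius inversion: the series for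
  \<open>\<Phi>\<^sub>n(e\<^sup>s)\<close> has coefficients \<open>B\<^sub>j\<^sup>+ J\<^sub>j(n) / j!\<close>. Going back from \<open>s\<close> to \<open>t = e\<^sup>s - 1\<close> brings in
  the Stirling numbers, because \<open>d/ds\<close> becomes \<open>(1 + t) d/dt\<close>, which shifts the Stirling
  transform by one index. Hence \<open>\<Phi>\<^sub>n(1 + t) / \<Phi>\<^sub>n(1)\<close> is the exponential of the series with
  coefficients \<open>x\<^sub>i / i!\<close>, which is the generating function of the complete Bell polynomials.
\<close>

section \<open>The Jordan totient summed over divisors\<close>

lemma jordan_totient_prime_power_mult:
  assumes "prime p" "\<not> p dvd m" "b > 0"
  shows "(jordan_totient j (p ^ b * m) :: 'a :: field_char_0) =
    of_nat (p ^ b) ^ j * (1 - 1 / of_nat p ^ j) * jordan_totient j m"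
proof -
  have "m \<noteq> 0" using assms by (intro notI) simp
  have "prime_factors (p ^ b * m) = insert p (prime_factors m)"
    using assms \<open>m \<noteq> 0\<close>
    by (simp add: prime_factors_product prime_factorization_prime_power)
  moreover have "p \<notin> prime_factors m" using assms by auto
  ultimately show ?thesis
    by (simp add: jordan_totient_def power_mult_distrib algebra_simps)
qed

text \<open>A divisor of p^(a+1) m either contains the full power p^(a+1) or already divides p^a
  m.\<close>

lemma divisors_prime_power_Suc_mult:
  fixes p m :: nat
  assumes "prime p" "\<not> p dvd m"
  shows "{d. d dvd p ^ Suc a * m} = {d. d dvd p ^ a * m} \<union> (\<lambda>d. p ^ Suc a * d) ` {d. d dvd m}"
proof (intro equalityI subsetI)
  fix d assume "d \<in> {d. d dvd p ^ Suc a * m}"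
  then obtain u v where uv: "d = u * v" "u dvd p ^ Suc a" "v dvd m"
    using division_decomp by blast
  then obtain b where b: "b \<le> Suc a" "u = p ^ b"
    using divides_primepow_nat[OF assms(1)] by blast
  show "d \<in> {d. d dvd p ^ a * m} \<union> (\<lambda>d. p ^ Suc a * d) ` {d. d dvd m}"
  proof (cases "b = Suc a")
    case True
    then show ?thesis using uv b by auto
  next
    case False
    then have "u dvd p ^ a" using b by (auto intro: le_imp_power_dvd)
    then show ?thesis using uv by (auto intro: mult_dvd_mono)
  qed
qed (auto intro: mult_dvd_mono dvd_trans[of _ "p ^ a * m"])

text \<open>The divisors gained from \<open>p ^ a * m\<close> to \<open>p ^ Suc a * m\<close>
  contribute (p^((a+1)j) - p^(aj)) m^j, so the sum telescopes.\<close>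

lemma sum_jordan_totient_prime_power_mult:
  fixes p m :: nat
  assumes p: "prime p" "\<not> p dvd m"
    and m: "(\<Sum>d | d dvd m. jordan_totient j d) = (of_nat m ^ j :: 'a :: field_char_0)"
  shows "(\<Sum>d | d dvd p ^ a * m. jordan_totient j d) = (of_nat (p ^ a * m) ^ j :: 'a)"
proof (induction a)
  case 0
  show ?case using m by simp
next
  case (Suc a)
  have p0: "p > 0" and m0: "m > 0" using p by (auto simp: prime_gt_0_nat intro!: gr0I)
  have ndvd: "\<not> p dvd d" if "d dvd m" for d
    using p that dvd_trans by blast
  have disj: "{d. d dvd p ^ a * m} \<inter> (\<lambda>d. p ^ Suc a * d) ` {d. d dvd m} = {}"
  proof -
    have False if "p ^ Suc a * d dvd p ^ a * m" for d
    proof -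
      have "p ^ a * (p * d) dvd p ^ a * m" using that by (simp add: ac_simps)
      then have "p * d dvd m" using p0 by (subst (asm) nat_mult_dvd_cancel_disj) auto
      then show False using p dvd_mult_left by blast
    qed
    then show ?thesis by blast
  qed
  have "(\<Sum>d | d dvd p ^ Suc a * m. jordan_totient j d :: 'a) =
      (\<Sum>d | d dvd p ^ a * m. jordan_totient j d) +
      (\<Sum>d\<in>(\<lambda>d. p ^ Suc a * d) ` {d. d dvd m}. jordan_totient j d)"
    unfolding divisors_prime_power_Suc_mult[OF p]
    using p0 m0 disj by (intro sum.union_disjoint) auto
  also have "(\<Sum>d\<in>(\<lambda>d. p ^ Suc a * d) ` {d. d dvd m}. jordan_totient j d :: 'a) =
      (\<Sum>d | d dvd m. jordan_totient j (p ^ Suc a * d))"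
    using p0 by (subst sum.reindex) (auto simp: inj_on_def)
  also have "\<dots> = (\<Sum>d | d dvd m. of_nat (p ^ Suc a) ^ j * (1 - 1 / of_nat p ^ j) *
      jordan_totient j d)"
    using p ndvd by (intro sum.cong refl jordan_totient_prime_power_mult) auto
  also have "\<dots> = of_nat (p ^ Suc a) ^ j * (1 - 1 / of_nat p ^ j) * of_nat m ^ j"
    by (simp add: m flip: sum_distrib_left)
  finally show ?case
    unfolding Suc using p0 by (simp add: field_simps power_mult_distrib)
qed

lemma sum_jordan_totient:
  assumes "n > 0"
  shows "(\<Sum>d | d dvd n. jordan_totient j d) = (of_nat n ^ j :: 'a :: field_char_0)"
  using assms
proof (induction n rule: less_induct)
  case (less n)
  show ?case
  proof (cases "n = 1")
    case True
    then show ?thesis by (simp add: jordan_totient_def)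
  next
    case False
    then obtain p where p: "prime p" "p dvd n" using prime_factor_nat by blast
    obtain m where m: "n = p ^ multiplicity p n * m" "\<not> p dvd m"
      using multiplicity_decompose'[of n p] less.prems p(1) not_prime_unit by blast
    have m0: "m > 0" using m less.prems by (auto intro!: gr0I)
    have "multiplicity p n > 0"
      using p less.prems by (simp add: prime_multiplicity_gt_zero_iff)
    then have "p ^ multiplicity p n > 1"
      using prime_gt_1_nat[OF p(1)] by (intro one_less_power)
    then have "m < p ^ multiplicity p n * m" using m0 by simp
    then have "m < n" using m(1) by simp
    with m0 less.IH have "(\<Sum>d | d dvd m. jordan_totient j d) = (of_nat m ^ j :: 'a)" by blast
    from sum_jordan_totient_prime_power_mult[OF p(1) m(2) this, of "multiplicity p n"]
    show ?thesis using m(1) by simp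
  qed
qed

section \<open>The complete Bell polynomial and power series\<close>

text \<open>The number m of variables is kept apart from the weight k because the recurrence lowers
  only k; \<open>bell_tuples k\<close> is the case m = k.\<close>

definition weighted_tuples :: "nat \<Rightarrow> nat \<Rightarrow> (nat \<Rightarrow> nat) set" where
  "weighted_tuples m k = {l \<in> {1..m} \<rightarrow>\<^sub>E UNIV. (\<Sum>j=1..m. j * l j) = k}"

text \<open>Summed over \<open>weighted_tuples m k\<close>, this gives the coefficient of t^k in
  exp(y_1 t + ... + y_m t^m).\<close>

definition tuple_weight :: "nat \<Rightarrow> (nat \<Rightarrow> 'a :: field_char_0) \<Rightarrow> (nat \<Rightarrow> nat) \<Rightarrow> 'a" where
  "tuple_weight m y l = (\<Prod>j=1..m. y j ^ l j / fact (l j))"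

lemma finite_weighted_tuples: "finite (weighted_tuples m k)"
proof (rule finite_subset)
  show "weighted_tuples m k \<subseteq> {1..m} \<rightarrow>\<^sub>E {..k}"
  proof
    fix l assume l: "l \<in> weighted_tuples m k"
    have "l i \<le> k" if i: "i \<in> {1..m}" for i
    proof -
      have "l i \<le> i * l i" using i by simp
      also have "\<dots> \<le> (\<Sum>i=1..m. i * l i)"
        using i by (intro member_le_sum[of i "{1..m}" "\<lambda>i. i * l i"]) auto
      also have "\<dots> = k" using l by (simp add: weighted_tuples_def)
      finally show ?thesis .
    qed
    then show "l \<in> {1..m} \<rightarrow>\<^sub>E {..k}" using l by (auto simp: weighted_tuples_def PiE_iff)
  qed
qed (simp add: finite_PiE)

text \<open>Lowering \<open>l j\<close> by one is a bijection on the tuples with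
  \<open>l j > 0\<close>; the factor \<open>l j\<close> cancels in the factorial and one
  \<open>y j\<close> comes out.\<close>

lemma sum_weighted_tuples_component:
  fixes y :: "nat \<Rightarrow> 'a :: field_char_0"
  assumes j: "j \<in> {1..m}"
  shows "(\<Sum>l\<in>weighted_tuples m k. of_nat (l j) * tuple_weight m y l) =
    (if j \<le> k then y j * (\<Sum>l\<in>weighted_tuples m (k - j). tuple_weight m y l) else 0)"
proof -
  have split: "(\<Sum>i=1..m. i * l i) = j * l j + (\<Sum>i\<in>{1..m}-{j}. i * l i)" for l :: "nat \<Rightarrow> nat"
    using j by (subst sum.remove[of _ j]) auto
  have wsplit: "tuple_weight m y l =
      y j ^ l j / fact (l j) * (\<Prod>i\<in>{1..m}-{j}. y i ^ l i / fact (l i))" for l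
    unfolding tuple_weight_def using j by (subst prod.remove[of _ j]) auto
  have le: "j * l j \<le> k" if "l \<in> weighted_tuples m k" for l
    using that split[of l] by (simp add: weighted_tuples_def)
  show ?thesis
  proof (cases "j \<le> k")
    case False
    have "l j = 0" if "l \<in> weighted_tuples m k" for l
      using le[OF that] False by (cases "l j") auto
    then show ?thesis using False by (auto intro!: sum.neutral)
  next
    case True
    have "(\<Sum>l\<in>weighted_tuples m k. of_nat (l j) * tuple_weight m y l) =
        (\<Sum>l\<in>{l \<in> weighted_tuples m k. l j > 0}. of_nat (l j) * tuple_weight m y l)"
      using finite_weighted_tuples by (intro sum.mono_neutral_right) auto
    also have "\<dots> = (\<Sum>l\<in>weighted_tuples m (k - j). y j * tuple_weight m y l)"
    proof (rule sum.reindex_bij_witness[of _ "\<lambda>l. l(j := Suc (l j))" "\<lambda>l. l(j := l j - 1)"])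
      fix l assume "l \<in> {l \<in> weighted_tuples m k. l j > 0}"
      then have l: "l \<in> weighted_tuples m k" and pos: "l j > 0" by auto
      then obtain r where r: "l j = Suc r" by (cases "l j") auto
      show "(l(j := l j - 1))(j := Suc ((l(j := l j - 1)) j)) = l" using pos by auto
      have "(\<Sum>i=1..m. i * (l(j := l j - 1)) i) = k - j"
        using l r split[of l] split[of "l(j := l j - 1)"] by (simp add: weighted_tuples_def)
      then show "l(j := l j - 1) \<in> weighted_tuples m (k - j)"
        using l j by (auto simp: weighted_tuples_def PiE_iff extensional_def)
      show "y j * tuple_weight m y (l(j := l j - 1)) = of_nat (l j) * tuple_weight m y l"
        unfolding wsplit[of l] wsplit[of "l(j := l j - 1)"] by (simp add: r field_simps del: of_nat_Suc)
    next
      fix l assume l: "l \<in> weighted_tuples m (k - j)"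
      show "(l(j := Suc (l j)))(j := (l(j := Suc (l j))) j - 1) = l" by auto
      have "(\<Sum>i=1..m. i * (l(j := Suc (l j))) i) = k"
        using l True split[of l] split[of "l(j := Suc (l j))"] by (simp add: weighted_tuples_def)
      then show "l(j := Suc (l j)) \<in> {l \<in> weighted_tuples m k. l j > 0}"
        using l j by (auto simp: weighted_tuples_def PiE_iff extensional_def)
    qed
    finally show ?thesis using True by (simp add: sum_distrib_left)
  qed
qed

text \<open>Write k as the sum of the \<open>j * l j\<close> inside every term and exchange the
  sums. This is the coefficient form of t E' = (t Y') E for E = exp Y.\<close>

lemma sum_weighted_tuples_recurrence:
  fixes y :: "nat \<Rightarrow> 'a :: field_char_0"
  assumes "k \<le> m"
  shows "of_nat k * (\<Sum>l\<in>weighted_tuples m k. tuple_weight m y l) =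
    (\<Sum>j=1..k. of_nat j * y j * (\<Sum>l\<in>weighted_tuples m (k - j). tuple_weight m y l))"
proof -
  have "of_nat k * (\<Sum>l\<in>weighted_tuples m k. tuple_weight m y l) =
      (\<Sum>l\<in>weighted_tuples m k. (\<Sum>j=1..m. of_nat j * (of_nat (l j) * tuple_weight m y l)))"
    unfolding sum_distrib_left
  proof (rule sum.cong[OF refl])
    fix l assume "l \<in> weighted_tuples m k"
    then have "of_nat k = (\<Sum>j=1..m. of_nat j * of_nat (l j) :: 'a)"
      by (auto simp: weighted_tuples_def)
    then show "of_nat k * tuple_weight m y l =
        (\<Sum>j=1..m. of_nat j * (of_nat (l j) * tuple_weight m y l))"
      by (simp add: sum_distrib_right mult.assoc)
  qed
  also have "\<dots> = (\<Sum>j=1..m. of_nat j *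
      (\<Sum>l\<in>weighted_tuples m k. of_nat (l j) * tuple_weight m y l))"
    by (subst sum.swap) (simp add: sum_distrib_left)
  also have "\<dots> = (\<Sum>j=1..m. of_nat j * (if j \<le> k then
      y j * (\<Sum>l\<in>weighted_tuples m (k - j). tuple_weight m y l) else 0))"
    by (intro sum.cong refl) (simp only: sum_weighted_tuples_component)
  also have "\<dots> = (\<Sum>j=1..k. of_nat j * y j *
      (\<Sum>l\<in>weighted_tuples m (k - j). tuple_weight m y l))"
    using assms by (intro sum.mono_neutral_cong_right) auto
  finally show ?thesis .
qed

lemma weighted_tuples_0: "weighted_tuples m 0 = {\<lambda>j\<in>{1..m}. 0}"
proof (intro equalityI subsetI)
  fix l assume l: "l \<in> weighted_tuples m 0"
  then have "l i = 0" if "i \<in> {1..m}" for i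
    using that by (auto simp: weighted_tuples_def)
  moreover have "l i = undefined" if "i \<notin> {1..m}" for i
    using l that unfolding weighted_tuples_def by (blast dest: PiE_arb)
  ultimately show "l \<in> {\<lambda>j\<in>{1..m}. 0}"
    by (simp add: restrict_def fun_eq_iff)
qed (auto simp: weighted_tuples_def)

lemma complete_bell_conv_weighted_tuples:
  "complete_bell k x = fact k * (\<Sum>l\<in>weighted_tuples k k. tuple_weight k (\<lambda>j. x j / fact j) l)"
  by (simp add: complete_bell_def bell_tuples_def weighted_tuples_def tuple_weight_def
      sum_distrib_left prod_dividef)

text \<open>The differential equation says that \<open>F = F(0) exp Y\<close> up to normalising \<open>Y(0)\<close>.\<close>
lemma fps_nth_eq_complete_bell:
  fixes F Y :: "'a :: field_char_0 fps"
  assumes ode: "fps_deriv F = fps_deriv Y * F"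
    and x: "\<And>i. 1 \<le> i \<Longrightarrow> i \<le> k \<Longrightarrow> x i = fact i * fps_nth Y i"
  shows "fact k * fps_nth F k = fps_nth F 0 * complete_bell k x"
proof -
  \<comment> \<open>With k variables throughout, all \<open>?S i\<close> for i \<le> k obey one
    recurrence, the same that the equation gives for the coefficients of \<open>F\<close>.\<close>
  let ?S = "\<lambda>i. \<Sum>l\<in>weighted_tuples k i. tuple_weight k (\<lambda>j. x j / fact j) l"
  have "i \<le> k \<Longrightarrow> fps_nth F i = fps_nth F 0 * ?S i" for i
  proof (induction i rule: less_induct)
    case (less i)
    show ?case
    proof (cases i)
      case 0
      then show ?thesis by (simp add: weighted_tuples_0 tuple_weight_def)
    next
      case (Suc r)
      have "of_nat i * fps_nth F i = fps_nth (fps_deriv Y * F) r"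
        using Suc by (simp flip: ode)
      also have "\<dots> = (\<Sum>j=0..r. of_nat (Suc j) * fps_nth Y (Suc j) * fps_nth F (r - j))"
        by (simp add: fps_mult_nth)
      also have "\<dots> = (\<Sum>j=1..i. of_nat j * fps_nth Y j * fps_nth F (i - j))"
        using sum.atLeast_Suc_atMost_Suc_shift[of "\<lambda>j. of_nat j * fps_nth Y j * fps_nth F (i - j)" 0 r]
        by (simp add: Suc)
      also have "\<dots> = (\<Sum>j=1..i. fps_nth F 0 * (of_nat j * (x j / fact j) * ?S (i - j)))"
      proof (intro sum.cong refl)
        fix j assume j: "j \<in> {1..i}"
        then have "fps_nth F (i - j) = fps_nth F 0 * ?S (i - j)"
          using less.prems by (intro less.IH) auto
        moreover have "fps_nth Y j = x j / fact j" using j less.prems by (simp add: x)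
        ultimately show "of_nat j * fps_nth Y j * fps_nth F (i - j) =
            fps_nth F 0 * (of_nat j * (x j / fact j) * ?S (i - j))"
          by (simp only: ac_simps)
      qed
      also have "\<dots> = fps_nth F 0 * (of_nat i * ?S i)"
        using sum_weighted_tuples_recurrence[OF less.prems, of "\<lambda>j. x j / fact j"]
        by (simp only: sum_distrib_left)
      finally have "of_nat i * fps_nth F i = of_nat i * (fps_nth F 0 * ?S i)" by simp
      then show ?thesis using Suc by (simp del: of_nat_Suc)
    qed
  qed
  from this[of k] show ?thesis by (simp add: complete_bell_conv_weighted_tuples)
qed

section \<open>Stirling numbers and the substitution of the exponential series\<close>

lemma signed_stirling_Suc:
  "signed_stirling (Suc i) j =
    (case j of 0 \<Rightarrow> 0 | Suc r \<Rightarrow> signed_stirling i r) - int i * signed_stirling i j"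
  by (simp add: signed_stirling_def coeff_pCons split: nat.split)

lemma signed_stirling_eq_0: "i < j \<Longrightarrow> signed_stirling i j = 0"
proof (induction i arbitrary: j)
  case 0
  then show ?case by (simp add: signed_stirling_def)
next
  case (Suc i)
  then show ?case by (cases j) (simp_all add: signed_stirling_Suc)
qed

text \<open>Formally the sum of a_j log(1+t)^j / j!, since log(1+t)^j / j! is the sum of s(i,j) t^i
  / i! over i.\<close>

definition stirling_series :: "(nat \<Rightarrow> 'a :: field_char_0) \<Rightarrow> 'a fps" where
  "stirling_series a = Abs_fps (\<lambda>i. (\<Sum>j\<le>i. a j * of_int (signed_stirling i j)) / fact i)"

text \<open>This rests on s(i+1,j) = s(i,j-1) - i s(i,j): multiplying the derivative by t supplies
  the missing term i s(i,j).\<close>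

lemma fps_deriv_stirling_series:
  "(1 + fps_X) * fps_deriv (stirling_series a) = stirling_series (\<lambda>j. a (Suc j))"
proof (rule fps_ext)
  fix i
  let ?A = "\<lambda>a i. \<Sum>j\<le>i. a j * of_int (signed_stirling i j) :: 'a"
  have "?A a (Suc i) = (\<Sum>j\<le>Suc i. a j * of_int (case j of 0 \<Rightarrow> 0 | Suc r \<Rightarrow> signed_stirling i r))
      - of_nat i * (\<Sum>j\<le>Suc i. a j * of_int (signed_stirling i j))"
    unfolding signed_stirling_Suc
    by (simp only: sum_subtractf sum_distrib_left of_int_diff of_int_mult of_int_of_nat_eq
        right_diff_distrib mult.left_commute)
  \<comment> \<open>The extra term j = i+1 vanishes because s(i,i+1) = 0.\<close>
  also have "(\<Sum>j\<le>Suc i. a j * of_int (signed_stirling i j)) = ?A a i"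
    by (simp add: signed_stirling_eq_0)
  also have "(\<Sum>j\<le>Suc i. a j * of_int (case j of 0 \<Rightarrow> 0 | Suc r \<Rightarrow> signed_stirling i r)) =
      ?A (\<lambda>j. a (Suc j)) i"
    by (subst sum.atMost_Suc_shift) simp
  finally have "?A a (Suc i) + of_nat i * ?A a i = ?A (\<lambda>j. a (Suc j)) i" by simp
  moreover have "fps_nth ((1 + fps_X) * fps_deriv (stirling_series a)) i =
      (?A a (Suc i) + of_nat i * ?A a i) / fact i"
    by (cases i) (simp_all add: stirling_series_def distrib_right field_simps del: of_nat_Suc sum.atMost_Suc)
  ultimately show "fps_nth ((1 + fps_X) * fps_deriv (stirling_series a)) i =
      fps_nth (stirling_series (\<lambda>j. a (Suc j))) i"
    by (simp add: stirling_series_def)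
qed

text \<open>Chain rule: the inner derivative e^s is 1 + t at t = e^s - 1.\<close>

lemma fps_deriv_compose_exp_minus_1:
  fixes F :: "'a :: field_char_0 fps"
  shows "fps_deriv (F oo (fps_exp 1 - 1)) = ((1 + fps_X) * fps_deriv F) oo (fps_exp 1 - 1)"
  by (simp add: fps_compose_deriv fps_compose_mult_distrib fps_compose_add_distrib)

text \<open>Substituting t = e^s - 1 inverts the Stirling transform. Each derivative in s shifts
  \<open>a\<close>, so the induction must leave \<open>a\<close> arbitrary.\<close>

lemma stirling_series_compose_exp:
  "fps_nth (stirling_series a oo (fps_exp 1 - 1)) n = a n / fact n"
proof (induction n arbitrary: a)
  case 0
  show ?case by (simp add: stirling_series_def signed_stirling_def)
next
  case (Suc n)
  have "of_nat (Suc n) * fps_nth (stirling_series a oo (fps_exp 1 - 1)) (Suc n) =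
      fps_nth (fps_deriv (stirling_series a oo (fps_exp 1 - 1))) n"
    by simp
  also have "\<dots> = a (Suc n) / fact n"
    by (simp add: fps_deriv_compose_exp_minus_1 fps_deriv_stirling_series Suc)
  finally show ?case by (simp add: field_simps del: of_nat_Suc)
qed

section \<open>Logarithmic derivatives of cyclotomic polynomials\<close>

text \<open>At n = 0 this is the whole complex plane, hence the positivity assumptions
  below.\<close>

definition primitive_roots :: "nat \<Rightarrow> complex set" where
  "primitive_roots n = {z. z ^ n = 1 \<and> (\<forall>m. 0 < m \<and> m < n \<longrightarrow> z ^ m \<noteq> 1)}"

text \<open>Each root of unity is primitive for its order, the least positive exponent, which
  divides n by division with remainder.\<close>

lemma roots_of_unity_partition:
  assumes "n > 0"
  shows "{z :: complex. z ^ n = 1} = (\<Union>d\<in>{d. d dvd n}. primitive_roots d)"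
proof (intro equalityI subsetI)
  fix z :: complex assume "z \<in> {z. z ^ n = 1}"
  then have z: "z ^ n = 1" by simp
  define d where "d = (LEAST m. 0 < m \<and> z ^ m = 1)"
  have d: "0 < d \<and> z ^ d = 1"
    unfolding d_def by (rule LeastI[of "\<lambda>m. 0 < m \<and> z ^ m = 1" n]) (use z assms in simp)
  have min: "z ^ m \<noteq> 1" if "0 < m" "m < d" for m
    using not_less_Least[of m "\<lambda>m. 0 < m \<and> z ^ m = 1"] that by (auto simp: d_def)
  have "z ^ n = (z ^ d) ^ (n div d) * z ^ (n mod d)"
    by (simp flip: power_add power_mult)
  then have "z ^ (n mod d) = 1" unfolding z by (simp add: d)
  then have "n mod d = 0" using min[of "n mod d"] d by auto
  then have "d dvd n" by presburger
  moreover have "z \<in> primitive_roots d"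
    using d min unfolding primitive_roots_def by blast
  ultimately show "z \<in> (\<Union>d\<in>{d. d dvd n}. primitive_roots d)" by blast
next
  fix z assume "z \<in> (\<Union>d\<in>{d. d dvd n}. primitive_roots d)"
  then obtain d where "d dvd n" and z: "z ^ d = 1" by (auto simp: primitive_roots_def)
  then obtain r where "n = d * r" by (elim dvdE)
  then show "z \<in> {z. z ^ n = 1}" using z by (simp add: power_mult)
qed

lemma disjoint_primitive_roots:
  assumes "d > 0" "e > 0" "d \<noteq> e"
  shows "primitive_roots d \<inter> primitive_roots e = {}"
proof -
  have False if "z \<in> primitive_roots d" "z \<in> primitive_roots e" for z
  proof -
    have "\<not> d < e" "\<not> e < d" using that assms(1,2) unfolding primitive_roots_def by blast+
    then show False using assms(3) by simp
  qed
  then show ?thesis by blast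
qed

lemma finite_primitive_roots: "n > 0 \<Longrightarrow> finite (primitive_roots n)"
  by (rule finite_subset[OF _ finite_roots_unity[of n]]) (simp_all add: primitive_roots_def Collect_mono)

text \<open>X^n - 1 is squarefree: its derivative n X^(n-1) can vanish only at 0, which is not a
  root.\<close>

lemma prod_roots_of_unity:
  assumes "n > 0"
  shows "(\<Prod>z | z ^ n = 1. [:- z, 1:]) = monom (1 :: complex) n - 1"
proof -
  let ?p = "monom (1 :: complex) n - 1"
  have deg: "degree ?p = n"
    using assms by (subst diff_conv_add_uminus, subst degree_add_eq_left) (simp_all add: degree_monom_eq)
  have lead: "lead_coeff ?p = 1" unfolding deg using assms by simp
  have "rsquarefree ?p"
    unfolding rsquarefree_roots
    using assms by (auto simp: pderiv_diff pderiv_monom poly_monom power_0_left)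
  from complex_poly_decompose_rsquarefree[OF this] show ?thesis
    unfolding lead by (simp add: poly_monom)
qed

text \<open>The series p(e^s). Shifting p by 1 first makes e^s - 1 the inner series, whose constant
  term is 0 as composition requires.\<close>

definition subst_exp :: "complex poly \<Rightarrow> complex fps" where
  "subst_exp p = fps_of_poly (pcompose p [:1, 1:]) oo (fps_exp 1 - 1)"

lemma subst_exp_prod: "subst_exp (\<Prod>z\<in>A. [:- z, 1:]) = (\<Prod>z\<in>A. fps_exp 1 - fps_const z)"
proof -
  have "fps_of_poly (pcompose [:- z, 1:] [:1, 1:]) oo (fps_exp 1 - 1) = fps_exp 1 - fps_const z"
    for z :: complex
  proof -
    have *: "fps_of_poly (pcompose [:- z, 1:] [:1, 1:]) = 1 + fps_X - fps_const z"
      by (simp add: pcompose_pCons fps_of_poly_linear flip: fps_const_neg fps_const_add)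
    show ?thesis
      unfolding *
      by (simp add: fps_compose_add_distrib fps_compose_sub_distrib)
  qed
  then show ?thesis
    by (simp add: subst_exp_def pcompose_prod fps_of_poly_prod fps_compose_prod_distrib)
qed

lemma subst_exp_monom_minus_1: "subst_exp (monom 1 n - 1) = fps_exp (of_nat n) - 1"
proof -
  have "pcompose (monom (1 :: complex) n) [:1, 1:] = [:1, 1:] ^ n"
    by (induction n) (simp_all add: monom_Suc pcompose_pCons monom_0 pcompose_1)
  then have *: "fps_of_poly (pcompose (monom (1 :: complex) n - 1) [:1, 1:]) = (1 + fps_X) ^ n - 1"
    by (simp add: pcompose_diff fps_of_poly_diff fps_of_poly_power pcompose_1
        fps_of_poly_linear add.commute)
  show ?thesis
    unfolding subst_exp_def *
    by (simp add: fps_compose_sub_distrib fps_compose_add_distrib fps_exp_power_mult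
        flip: fps_compose_power)
qed

text \<open>The logarithmic derivative of \<open>e\<^sup>s - z\<close>, multiplied by \<open>s\<close> so that it remains a power
  series when \<open>z = 1\<close>.\<close>
definition logderiv_factor :: "complex \<Rightarrow> complex fps" where
  "logderiv_factor z = fps_X * fps_exp 1 / (fps_exp 1 - fps_const z)"

text \<open>For z = 1 the denominator is not a unit, but the Bernoulli identity shows that it
  divides the numerator.\<close>

lemma logderiv_factor: "logderiv_factor z * (fps_exp 1 - fps_const z) = fps_X * fps_exp 1"
proof (cases "z = 1")
  case True
  have "fps_exp 1 - 1 dvd fps_X * fps_exp (1 :: complex)"
    using bernoulli_plus_egf by (metis dvd_triv_right)
  then show ?thesis using True by (simp add: logderiv_factor_def)
next
  case False
  then have "is_unit (fps_exp 1 - fps_const z)" by (simp add: fps_is_unit_iff)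
  then show ?thesis by (simp add: logderiv_factor_def)
qed

text \<open>The product rule, multiplied out so that nothing is divided by the product.\<close>

lemma sum_logderiv_factor:
  "(\<Sum>z\<in>A. logderiv_factor z) * (\<Prod>z\<in>A. fps_exp 1 - fps_const z) =
    fps_X * fps_deriv (\<Prod>z\<in>A. fps_exp 1 - fps_const z)"
proof (induction A rule: infinite_finite_induct)
  case (insert a A)
  let ?f = "\<lambda>z :: complex. fps_exp 1 - fps_const z" and ?g = logderiv_factor
  have "(\<Sum>z\<in>insert a A. ?g z) * (\<Prod>z\<in>insert a A. ?f z) =
      (?g a * ?f a) * prod ?f A + ?f a * (sum ?g A * prod ?f A)"
    using insert.hyps by (simp add: algebra_simps)
  also have "\<dots> = fps_X * fps_deriv (\<Prod>z\<in>insert a A. ?f z)"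
    unfolding logderiv_factor insert.IH using insert.hyps by (simp add: algebra_simps)
  finally show ?case .
qed simp_all

text \<open>The factors multiply to e^(ns) - 1, so the sum is ns e^(ns) / (e^(ns) - 1), the
  Bernoulli series at ns.\<close>

lemma sum_logderiv_factor_roots_of_unity:
  assumes "n > 0"
  shows "(\<Sum>z | z ^ n = 1. logderiv_factor z) =
    Abs_fps (\<lambda>j. bernoulli_plus j * of_nat n ^ j / fact j)"
proof -
  let ?c = "of_nat n :: complex"
  let ?B = "Abs_fps (\<lambda>j. bernoulli_plus j / fact j) :: complex fps"
  have E: "(\<Prod>z | z ^ n = 1. fps_exp 1 - fps_const z) = fps_exp ?c - 1"
    by (simp add: prod_roots_of_unity[OF assms] subst_exp_monom_minus_1 flip: subst_exp_prod)
  have "(?B * (fps_exp 1 - 1)) oo (fps_const ?c * fps_X) =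
      (fps_X * fps_exp 1) oo (fps_const ?c * fps_X)"
    by (simp only: bernoulli_plus_egf)
  then have "(?B oo (fps_const ?c * fps_X)) * (fps_exp ?c - 1) = fps_const ?c * fps_X * fps_exp ?c"
    by (simp add: fps_compose_mult_distrib fps_compose_sub_distrib)
  also have "\<dots> = (\<Sum>z | z ^ n = 1. logderiv_factor z) * (fps_exp ?c - 1)"
    using sum_logderiv_factor[of "{z. z ^ n = 1}"] unfolding E by (simp add: ac_simps)
  finally have "?B oo (fps_const ?c * fps_X) = (\<Sum>z | z ^ n = 1. logderiv_factor z)"
  proof (subst (asm) mult_cancel_right, elim disjE)
    assume "fps_exp ?c - 1 = 0"
    then have "fps_nth (fps_exp ?c - 1) 1 = 0" by simp
    then show ?thesis using assms by simp
  qed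
  then show ?thesis by (simp add: fps_compose_linear mult.commute[of "_ ^ _"])
qed

text \<open>Both sides have the same sum over the divisors of n, and the induction hypothesis
  cancels the proper ones.\<close>

lemma sum_logderiv_factor_primitive_roots:
  assumes "n > 0"
  shows "(\<Sum>z\<in>primitive_roots n. logderiv_factor z) =
    Abs_fps (\<lambda>j. bernoulli_plus j * jordan_totient j n / fact j)"
  using assms
proof (induction n rule: less_induct)
  case (less n)
  let ?G = "\<lambda>d. \<Sum>z\<in>primitive_roots d. logderiv_factor z"
  let ?H = "\<lambda>d. Abs_fps (\<lambda>j. bernoulli_plus j * jordan_totient j d / fact j) :: complex fps"
  let ?D = "{d. d dvd n}"
  have fin: "finite ?D" and pos: "\<And>d. d \<in> ?D \<Longrightarrow> d > 0"
    using less.prems by (auto intro: dvd_pos_nat)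
  have "(\<Sum>d\<in>?D. ?G d) = (\<Sum>z | z ^ n = 1. logderiv_factor z)"
    unfolding roots_of_unity_partition[OF less.prems]
    using fin pos finite_primitive_roots disjoint_primitive_roots
    by (subst sum.UNION_disjoint) auto
  also have "\<dots> = (\<Sum>d\<in>?D. ?H d)"
    by (simp add: fps_eq_iff fps_sum_nth sum_logderiv_factor_roots_of_unity less.prems
        sum_jordan_totient flip: sum_distrib_left sum_divide_distrib)
  finally have "?G n + sum ?G (?D - {n}) = ?H n + sum ?H (?D - {n})"
    using fin sum.remove[of ?D n ?G] sum.remove[of ?D n ?H] by simp
  moreover have "sum ?G (?D - {n}) = sum ?H (?D - {n})"
    proof (intro sum.cong refl less.IH)
    fix d assume "d \<in> ?D - {n}"
    then show "d < n" "d > 0" using less.prems pos[of d] by (auto dest: dvd_imp_le)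
  qed
  ultimately show ?case by simp
qed

section \<open>Derivatives at \<open>1\<close>\<close>

lemma higher_pderiv_pcompose_shift:
  "(pderiv ^^ k) (pcompose p [:c, 1:]) = pcompose ((pderiv ^^ k) p) [:c, 1:]"
  by (induction k) (simp_all add: pderiv_pcompose pderiv_pCons)

theorem theorem3p4:
  fixes k n :: nat and x :: "nat \<Rightarrow> complex"
  assumes "n \<ge> 2"
    and "\<And>i. 1 \<le> i \<Longrightarrow> i \<le> k \<Longrightarrow>
      x i = (\<Sum>j=1..i. bernoulli_plus j * of_int (signed_stirling i j) / of_nat j
                      * jordan_totient j n)"
  shows "poly ((pderiv ^^ k) (cyclotomic n)) 1 / poly (cyclotomic n) 1 = complete_bell k x"
proof -
  define a :: "nat \<Rightarrow> complex" where "a j = bernoulli_plus j * jordan_totient j n / of_nat j" for j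
    \<comment> \<open>\<open>a 0 = 0\<close>, since division by \<open>0\<close> gives \<open>0\<close>\<close>
  define F where "F = fps_of_poly (pcompose (cyclotomic n) [:1, 1:])"
  \<comment> \<open>This will be log \<open>F\<close> up to a constant; the division by j in
    \<open>a\<close> offsets the factor j produced by s d/ds.\<close>
  define Y where "Y = stirling_series a"
  let ?L = "fps_exp 1 - 1 :: complex fps"
  have cyc: "cyclotomic n = (\<Prod>z\<in>primitive_roots n. [:- z, 1:])"
    by (simp add: cyclotomic_def primitive_roots_def)
  have deriv: "poly ((pderiv ^^ i) (cyclotomic n)) 1 = fact i * fps_nth F i" for i
  proof -
    have "poly ((pderiv ^^ i) (cyclotomic n)) 1 =
        coeff ((pderiv ^^ i) (pcompose (cyclotomic n) [:1, 1:])) 0"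
      by (simp add: higher_pderiv_pcompose_shift poly_pcompose flip: poly_0_coeff_0)
    then show ?thesis
      by (simp add: coeff_higher_pderiv F_def pochhammer_fact)
  qed
  have "1 \<notin> primitive_roots n"
    using assms(1) by (auto simp: primitive_roots_def intro!: exI[of _ 1])
  then have nz: "poly (cyclotomic n) 1 \<noteq> 0"
    using assms(1) finite_primitive_roots[of n] by (auto simp: cyc poly_prod)
  \<comment> \<open>At exponent 0 every prime factor of n contributes 1 - 1 = 0. This matches the
    constant term of s d/ds of a series, which is 0.\<close>
  have J0: "jordan_totient 0 n = (0 :: complex)"
  proof -
    obtain p where "prime p" "p dvd n" using prime_factor_nat[of n] assms(1) by auto
    then have "prime_factors n \<noteq> {}" using assms(1) by (auto simp: prime_factors_dvd)
    then show ?thesis by (simp add: jordan_totient_def card_gt_0_iff)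
  qed
  have "fps_X * fps_deriv (Y oo ?L) = (\<Sum>z\<in>primitive_roots n. logderiv_factor z)"
  proof (rule fps_ext)
    fix i
    show "fps_nth (fps_X * fps_deriv (Y oo ?L)) i =
        fps_nth (\<Sum>z\<in>primitive_roots n. logderiv_factor z) i"
      using assms(1)
      by (cases i) (simp_all add: sum_logderiv_factor_primitive_roots J0 Y_def
          stirling_series_compose_exp a_def field_simps del: of_nat_Suc)
  qed
  moreover have "F oo ?L = (\<Prod>z\<in>primitive_roots n. fps_exp 1 - fps_const z)"
    by (simp add: F_def cyc flip: subst_exp_prod subst_exp_def)
  ultimately have "fps_X * fps_deriv (F oo ?L) = fps_X * (fps_deriv (Y oo ?L) * (F oo ?L))"
    using sum_logderiv_factor[of "primitive_roots n"] by (simp only: mult.assoc[symmetric])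
  then have "fps_deriv (F oo ?L) = fps_deriv (Y oo ?L) * (F oo ?L)"
    by simp
  then have "((1 + fps_X) * fps_deriv F) oo ?L = ((1 + fps_X) * (fps_deriv Y * F)) oo ?L"
    by (simp add: fps_deriv_compose_exp_minus_1 fps_compose_mult_distrib mult.assoc)
  \<comment> \<open>The series e^s - 1 has zero constant and nonzero linear coefficient, so
    substituting it is injective.\<close>
  then have "(1 + fps_X) * fps_deriv F = (1 + fps_X) * (fps_deriv Y * F)"
    by (simp add: fps_compose_inj_right)
  moreover have "(1 + fps_X :: complex fps) \<noteq> 0"
    by (auto simp: fps_eq_iff intro!: exI[of _ 0])
  ultimately have "fps_deriv F = fps_deriv Y * F" by simp
  moreover have "x i = fact i * fps_nth Y i" if "1 \<le> i" "i \<le> k" for i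
  proof -
    have "(\<Sum>j\<le>i. a j * of_int (signed_stirling i j)) = (\<Sum>j=1..i. a j * of_int (signed_stirling i j))"
      by (intro sum.mono_neutral_right) (auto simp: a_def not_less_eq_eq)
    then show ?thesis
      using assms(2)[OF that] by (simp add: Y_def stirling_series_def a_def ac_simps)
  qed
  ultimately have "fact k * fps_nth F k = fps_nth F 0 * complete_bell k x"
    by (rule fps_nth_eq_complete_bell)
  moreover have "poly (cyclotomic n) 1 = fps_nth F 0"
    using deriv[of 0] by simp
  ultimately show ?thesis using nz by (simp add: deriv)
qed

end
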